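(* Let $n\ge1$ and let $A_1,\dots,A_n$ be distinct nonzero complex numbers. Then, as formal series in $x,x^{-1}$, $$\prod_{i=1}^n\frac1{1-A_ix}-(-1)^n\prod_{i=1}^n\frac{A_i^{-1}x^{-1}}{1-A_i^{-1}x^{-1}}=\sum_{i=1}^n\Big(\prod_{1\le j\le n,\,j\ne i}\frac{A_i}{A_i-A_j}\Big)\delta(A_ix).$$
   Context: $\delta(x)=\sum_{n\in\mathbb Z}x^n$. Each $\frac1{1-Ax}$ is expanded as $\sum_{n\ge0}A^nx^n$ (non-negative powers of $x$) and each $\frac{A^{-1}x^{-1}}{1-A^{-1}x^{-1}}$ as $\sum_{n\ge1}A^{-n}x^{-n}$ (negative powers of $x$). *)

theory Defs
  imports Complex_Main "HOL-Computational_Algebra.Formal_Power_Series"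
begin

text \<open>
  A formal series in x and 1/x, infinite in both directions, is given by its coefficients:
  \<open>u k\<close> is the coefficient of x to the power k, for every integer k. Formal Laurent series
  (type \<open>fls\<close>) do not suffice here, as they have only finitely many negative powers.

  Such series cannot be multiplied in general. The products considered here are
  taken in the ring of power series in x, respectively in the ring of power series in 1/x,
  and then viewed as two-sided series through the embeddings \<open>series_x\<close> and \<open>series_x_inv\<close>.
\<close>

type_synonym bi_series = "int \<Rightarrow> complex"

definition series_x :: "complex fps \<Rightarrow> bi_series" where
  "series_x f = (\<lambda>k. if k \<ge> 0 then fps_nth f (nat k) else 0)"

text \<open>Here the variable of the power series stands for 1/x.\<close>

definition series_x_inv :: "complex fps \<Rightarrow> bi_series" where
  "series_x_inv f = (\<lambda>k. if k \<le> 0 then fps_nth f (nat (- k)) else 0)"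

definition delta :: bi_series where
  "delta = (\<lambda>k. 1)"

text \<open>The series u(ax) obtained from u(x), for nonzero a.\<close>

definition scale_var :: "complex \<Rightarrow> bi_series \<Rightarrow> bi_series" where
  "scale_var a u = (\<lambda>k. a powi k * u k)"

definition geom :: "complex \<Rightarrow> complex fps" where
  "geom a = 1 / (1 - fps_const a * fps_X)"

text \<open>With \<open>a = 1/A\<close> and the variable read as 1/x, this is the second kind of factor.\<close>

definition geom_tail :: "complex \<Rightarrow> complex fps" where
  "geom_tail a = (fps_const a * fps_X) / (1 - fps_const a * fps_X)"

text \<open>The quotients above, taken in the ring of power series, are the intended expansions.\<close>

lemma geom_eq: "geom a = Abs_fps (\<lambda>n. a ^ n)"
proof -
  have "(1 - fps_const a * fps_X) * Abs_fps (\<lambda>n. a ^ n) = 1"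
  proof (rule fps_ext)
    fix n
    show "fps_nth ((1 - fps_const a * fps_X) * Abs_fps (\<lambda>n. a ^ n)) n = fps_nth 1 n"
      by (cases n) (simp_all add: left_diff_distrib mult.assoc)
  qed
  then have "inverse (1 - fps_const a * fps_X) = Abs_fps (\<lambda>n. a ^ n)"
    by (rule fps_inverse_unique)
  then show ?thesis
    by (simp add: geom_def fps_divide_unit)
qed

lemma geom_tail_eq: "geom_tail a = Abs_fps (\<lambda>n. if n = 0 then 0 else a ^ n)"
proof -
  have "geom_tail a = fps_const a * fps_X * geom a"
    by (simp add: geom_def geom_tail_def fps_divide_unit)
  also have "\<dots> = Abs_fps (\<lambda>n. if n = 0 then 0 else a ^ n)"
  proof (rule fps_ext)
    fix n
    show "fps_nth (fps_const a * fps_X * geom a) n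
        = fps_nth (Abs_fps (\<lambda>n. if n = 0 then 0 else a ^ n)) n"
      by (cases n) (simp_all add: geom_eq mult.assoc)
  qed
  finally show ?thesis .
qed

lemma series_x_geom: "series_x (geom a) = (\<lambda>k. if k \<ge> 0 then a powi k else 0)"
  by (auto simp: series_x_def geom_eq power_int_def)

lemma series_x_inv_geom_tail:
  "series_x_inv (geom_tail (inverse a)) = (\<lambda>k. if k < 0 then a powi k else 0)"
  by (auto simp: series_x_inv_def geom_tail_eq power_int_def)

end

theory Submission
  imports Defs
begin

text \<open>
  The series \<open>1/(1 - Ax)\<close> and \<open>- (1/(Ax)) / (1 - 1/(Ax))\<close> are the expansions of one rational
  function, at \<open>x = 0\<close> and at \<open>x = \<infinity>\<close>. The partial fraction decomposition
  \<open>\<Prod>\<^sub>i 1/(1 - A\<^sub>i x) = \<Sum>\<^sub>i c\<^sub>i / (1 - A\<^sub>i x)\<close> with \<open>c\<^sub>i = \<Prod>\<^sub>j\<^sub>\<noteq>\<^sub>i A\<^sub>i / (A\<^sub>i - A\<^sub>j)\<close> therefore holds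
  for both expansions, with the same coefficients, and the left-hand side of the theorem is
  the difference of the two. The sign \<open>(- 1) ^ n\<close> is absorbed by the minus signs of the \<open>n\<close>
  factors. Term by term, the difference of the two expansions of \<open>1/(1 - A\<^sub>i x)\<close> is the sum of
  \<open>A\<^sub>i\<^sup>k x\<^sup>k\<close> over all integers \<open>k\<close>, which is \<open>\<delta>(A\<^sub>i x)\<close>.

  To have the decomposition once for both expansions, \<open>1/(1 - ax)\<close> is
  replaced by \<open>w/(w - az)\<close>, that is, by a solution \<open>t\<close> of \<open>(w - a * z) * t = w\<close> in an integral
  domain: \<open>w = 1\<close>, \<open>z = X\<close> gives power series in \<open>x\<close>, and \<open>w = X\<close>, \<open>z = 1\<close> gives power
  series in \<open>1/x\<close> (\<open>partial_fractions\<close>).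
\<close>

text \<open>
  Multiplied by the nonzero element \<open>(w - a * z) * (w - b * z)\<close>, the claim becomes
  \<open>w\<^sup>2 = p * w * (w - b * z) + q * w * (w - a * z)\<close>, which holds because \<open>p * b + q * a = 0\<close>.
\<close>

lemma partial_fractions_two:
  fixes a b p q s t w z :: "'b::idom"
  assumes "w \<noteq> 0" and s: "(w - a * z) * s = w" and t: "(w - b * z) * t = w"
    and "a \<noteq> b" and p: "p * (a - b) = a" and q: "q * (b - a) = b"
  shows "s * t = p * s + q * t"
proof -
  have "(p + q - 1) * (a - b) = p * (a - b) - q * (b - a) - (a - b)"
    by (simp add: algebra_simps)
  also have "\<dots> = 0"
    by (simp add: p q)
  finally have pq: "p + q = 1"
    using \<open>a \<noteq> b\<close> by simp
  have pbqa: "p * b + q * a = 0"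
  proof -
    have "p * b + q * a = (p + q) * a - p * (a - b)"
      by (simp add: algebra_simps)
    then show ?thesis by (simp add: p pq)
  qed
  let ?u = "w - a * z" and ?v = "w - b * z"
  have "?u * ?v * (s * t) = (?u * s) * (?v * t)"
    by (simp only: ac_simps)
  also have "\<dots> = (p + q) * w * w - (p * b + q * a) * z * w"
    by (simp add: s t pq pbqa)
  also have "\<dots> = p * ?v * w + q * ?u * w"
    by (simp add: algebra_simps)
  also have "\<dots> = p * ?v * (?u * s) + q * ?u * (?v * t)"
    by (simp only: s t)
  also have "\<dots> = ?u * ?v * (p * s + q * t)"
    by (simp add: distrib_left ac_simps)
  finally have "?u * ?v * (s * t) = ?u * ?v * (p * s + q * t)" .
  moreover have "?u * ?v \<noteq> 0"
    using s t \<open>w \<noteq> 0\<close> by auto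
  ultimately show ?thesis
    by (metis mult_left_cancel)
qed

text \<open>
  By induction, adding a factor \<open>t m\<close> and decomposing each \<open>t i * t m\<close> leaves one thing
  to verify: that the coefficients collected at \<open>t m\<close> add up to the product of all \<open>c m i\<close>. This
  is the decomposition again, for the old index set, since \<open>c m i = a m / (a m - a i)\<close> itself
  has the form \<open>w / (w - a i * z)\<close>, with \<open>w = a m\<close> and \<open>z = 1\<close>. For that reason \<open>t\<close>, \<open>w\<close> and
  \<open>z\<close> vary in the induction.
\<close>

lemma partial_fractions:
  fixes a t :: "'i \<Rightarrow> 'b::idom" and c :: "'i \<Rightarrow> 'i \<Rightarrow> 'b"
  assumes "finite S" "S \<noteq> {}" "inj_on a S" "\<And>i. i \<in> S \<Longrightarrow> a i \<noteq> 0"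
    and "\<And>i j. i \<in> S \<Longrightarrow> j \<in> S \<Longrightarrow> i \<noteq> j \<Longrightarrow> c i j * (a i - a j) = a i"
    and "w \<noteq> 0" and "\<And>i. i \<in> S \<Longrightarrow> (w - a i * z) * t i = w"
  shows "(\<Prod>i\<in>S. t i) = (\<Sum>i\<in>S. (\<Prod>j\<in>S - {i}. c i j) * t i)"
  using assms
proof (induction S arbitrary: t w z rule: finite_ne_induct)
  case (singleton m)
  then show ?case by simp
next
  case (insert m S)
  let ?C = "\<lambda>i. \<Prod>j\<in>S - {i}. c i j"
  have inj: "inj_on a S" and neq: "\<And>i. i \<in> S \<Longrightarrow> a i \<noteq> a m" and ne: "\<And>i. i \<in> S \<Longrightarrow> i \<noteq> m"
    using insert.prems(1) insert.hyps(3) by (auto simp: inj_on_def)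
  have c: "\<And>i j. i \<in> S \<Longrightarrow> j \<in> S \<Longrightarrow> i \<noteq> j \<Longrightarrow> c i j * (a i - a j) = a i"
    and cm: "\<And>i. i \<in> S \<Longrightarrow> c m i * (a m - a i) = a m"
    and cm': "\<And>i. i \<in> S \<Longrightarrow> c i m * (a i - a m) = a i"
    using insert.prems(3) ne by auto
  have old: "(\<Prod>i\<in>S. t i) = (\<Sum>i\<in>S. ?C i * t i)"
    using insert.prems by (intro insert.IH[OF inj _ c, of w z]) auto
  have at_m: "(\<Prod>i\<in>S. c m i) = (\<Sum>i\<in>S. ?C i * c m i)"
    using insert.prems cm by (intro insert.IH[OF inj _ c, of "a m" 1]) (auto simp: mult.commute)
  have pair: "t i * t m = c i m * t i + c m i * t m" if "i \<in> S" for i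
    using that insert.prems
    by (intro partial_fractions_two[of w "a i" z "t i" "a m" "t m"]) (auto simp: neq cm cm')
  have new: "(\<Prod>j\<in>insert m S - {i}. c i j) = c i m * ?C i" if "i \<in> S" for i
  proof -
    have "insert m S - {i} = insert m (S - {i})"
      using ne[OF that] by auto
    then show ?thesis
      using insert.hyps by simp
  qed
  have "(\<Prod>i\<in>insert m S. t i) = (\<Sum>i\<in>S. ?C i * (t i * t m))"
    using insert.hyps by (simp add: old sum_distrib_left ac_simps)
  also have "\<dots> = (\<Sum>i\<in>S. ?C i * (c i m * t i + c m i * t m))"
    by (simp add: pair)
  also have "\<dots> = (\<Sum>i\<in>S. (c i m * ?C i) * t i) + (\<Sum>i\<in>S. ?C i * c m i) * t m"
    by (simp add: distrib_left sum.distrib sum_distrib_left sum_distrib_right ac_simps)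
  also have "\<dots> = (\<Sum>i\<in>S. (\<Prod>j\<in>insert m S - {i}. c i j) * t i) + (\<Prod>i\<in>S. c m i) * t m"
    by (simp add: new at_m)
  also have "\<dots> = (\<Sum>i\<in>insert m S. (\<Prod>j\<in>insert m S - {i}. c i j) * t i)"
    using insert.hyps by simp
  finally show ?case .
qed

lemma fps_partial_fractions:
  fixes A :: "'i \<Rightarrow> 'k::field" and t :: "'i \<Rightarrow> 'k fps"
  assumes "finite S" "S \<noteq> {}" "inj_on A S" "\<And>i. i \<in> S \<Longrightarrow> A i \<noteq> 0"
    and "w \<noteq> 0" and "\<And>i. i \<in> S \<Longrightarrow> (w - fps_const (A i) * z) * t i = w"
  shows "(\<Prod>i\<in>S. t i) = (\<Sum>i\<in>S. fps_const (\<Prod>j\<in>S - {i}. A i / (A i - A j)) * t i)"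
proof -
  have const_prod: "fps_const (\<Prod>j\<in>T. f j) = (\<Prod>j\<in>T. fps_const (f j))"
    for T and f :: "'i \<Rightarrow> 'k"
    by (induction T rule: infinite_finite_induct) (simp_all flip: fps_const_mult)
  have "(\<Prod>i\<in>S. t i) = (\<Sum>i\<in>S. (\<Prod>j\<in>S - {i}. fps_const (A i / (A i - A j))) * t i)"
  proof (rule partial_fractions[where a = "\<lambda>i. fps_const (A i)" and w = w and z = z])
    fix i j assume "i \<in> S" "j \<in> S" "i \<noteq> j"
    then have "A i - A j \<noteq> 0"
      using assms(3) by (auto simp: inj_on_def)
    then show "fps_const (A i / (A i - A j)) * (fps_const (A i) - fps_const (A j))
        = fps_const (A i)"
      by simp
  next
    show "inj_on (\<lambda>i. fps_const (A i)) S"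
      using assms(3) unfolding inj_on_def by (metis fps_nth_fps_const)
  next
    show "fps_const (A i) \<noteq> 0" if "i \<in> S" for i
      using assms(4)[OF that] by simp
  qed (use assms in auto)
  then show ?thesis
    by (simp add: const_prod)
qed

lemma geom_cancel: "(1 - fps_const a * fps_X) * geom a = 1"
  by (simp add: geom_def fps_divide_unit inverse_mult_eq_1')

text \<open>
  In the variable \<open>y = 1/x\<close> the fraction \<open>1/(1 - ax)\<close> reads \<open>y/(y - a)\<close>; this determines the
  sign in front of the second expansion.
\<close>

lemma geom_tail_cancel:
  assumes "a \<noteq> 0"
  shows "(fps_X - fps_const a * 1) * (- geom_tail (inverse a)) = fps_X"
proof -
  let ?u = "1 - fps_const (inverse a) * fps_X"
  have "?u * geom_tail (inverse a)
      = (?u * inverse ?u) * (fps_const (inverse a) * fps_X)"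
    by (simp add: geom_tail_def fps_divide_unit ac_simps)
  also have "\<dots> = fps_const (inverse a) * fps_X"
    by (simp add: inverse_mult_eq_1')
  finally have tail: "?u * geom_tail (inverse a) = fps_const (inverse a) * fps_X" .
  have inv: "fps_const a * fps_const (inverse a) = 1"
    using assms by simp
  have factor: "fps_const a - fps_X = fps_const a * ?u"
    by (simp only: right_diff_distrib mult_1_right mult.assoc[symmetric] inv mult_1_left)
  have "(fps_X - fps_const a * 1) * (- geom_tail (inverse a))
      = (fps_const a - fps_X) * geom_tail (inverse a)"
    by (simp add: algebra_simps)
  also have "\<dots> = fps_const a * (?u * geom_tail (inverse a))"
    by (simp only: factor mult.assoc)
  also have "\<dots> = fps_X"
    by (simp only: tail mult.assoc[symmetric] inv mult_1_left)
  finally show ?thesis .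
qed

lemma series_x_lincomb:
  "series_x (\<Sum>i\<in>S. fps_const (c i) * f i) k = (\<Sum>i\<in>S. c i * series_x (f i) k)"
  by (simp add: series_x_def fps_sum_nth)

lemma series_x_inv_lincomb:
  "series_x_inv (\<Sum>i\<in>S. fps_const (c i) * f i) k = (\<Sum>i\<in>S. c i * series_x_inv (f i) k)"
  by (simp add: series_x_inv_def fps_sum_nth)

lemma series_x_inv_uminus: "series_x_inv (- f) k = - series_x_inv f k"
  by (simp add: series_x_inv_def)

lemma series_x_inv_minus_one_power:
  "series_x_inv ((- 1) ^ n * f) k = (- 1) ^ n * series_x_inv f k"
  by (cases "even n") (simp_all add: series_x_inv_uminus)

lemma expansions_difference_delta:
  "series_x (geom a) k + series_x_inv (geom_tail (inverse a)) k = scale_var a delta k"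
  by (simp add: series_x_geom series_x_inv_geom_tail scale_var_def delta_def)

theorem proposition2p8:
  fixes n :: nat and A :: "nat \<Rightarrow> complex"
  assumes "n \<ge> 1"
    and "inj_on A {1..n}"
    and "\<forall>i\<in>{1..n}. A i \<noteq> 0"
  shows "(\<lambda>k. series_x (\<Prod>i=1..n. geom (A i)) k
            - (- 1) ^ n * series_x_inv (\<Prod>i=1..n. geom_tail (inverse (A i))) k)
       = (\<lambda>k. \<Sum>i=1..n. (\<Prod>j\<in>{1..n} - {i}. A i / (A i - A j)) * scale_var (A i) delta k)"
proof
  fix k
  let ?c = "\<lambda>i. \<Prod>j\<in>{1..n} - {i}. A i / (A i - A j)"
  have at_zero: "(\<Prod>i=1..n. geom (A i)) = (\<Sum>i=1..n. fps_const (?c i) * geom (A i))"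
    using assms by (intro fps_partial_fractions[where w = 1 and z = fps_X])
      (auto simp: geom_cancel)
  have at_infinity: "(\<Prod>i=1..n. - geom_tail (inverse (A i)))
      = (\<Sum>i=1..n. fps_const (?c i) * - geom_tail (inverse (A i)))"
    using assms geom_tail_cancel by (intro fps_partial_fractions[where w = fps_X and z = 1]) auto
  have "(- 1) ^ n * series_x_inv (\<Prod>i=1..n. geom_tail (inverse (A i))) k
      = series_x_inv (\<Prod>i=1..n. - geom_tail (inverse (A i))) k"
    by (simp add: prod_uminus series_x_inv_minus_one_power)
  also have "\<dots> = - (\<Sum>i=1..n. ?c i * series_x_inv (geom_tail (inverse (A i))) k)"
    by (simp only: at_infinity series_x_inv_lincomb series_x_inv_uminus
        mult_minus_right sum_negf)
  finally have "series_x (\<Prod>i=1..n. geom (A i)) k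
      - (- 1) ^ n * series_x_inv (\<Prod>i=1..n. geom_tail (inverse (A i))) k
      = (\<Sum>i=1..n. ?c i * series_x (geom (A i)) k)
        + (\<Sum>i=1..n. ?c i * series_x_inv (geom_tail (inverse (A i))) k)"
    by (simp only: at_zero series_x_lincomb diff_minus_eq_add)
  also have "\<dots> = (\<Sum>i=1..n. ?c i * scale_var (A i) delta k)"
    by (simp only: sum.distrib[symmetric] distrib_left[symmetric] expansions_difference_delta)
  finally show "series_x (\<Prod>i=1..n. geom (A i)) k
      - (- 1) ^ n * series_x_inv (\<Prod>i=1..n. geom_tail (inverse (A i))) k
      = (\<Sum>i=1..n. ?c i * scale_var (A i) delta k)" .
qed

end
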